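(* There exists a finite nonabelian group $G$ for which the abelianization condition is not sufficient for quotient-realizability; that is, there is a multiset $A$ of cardinality $|G|$ with elements in $G$ that satisfies the abelianization condition but is not quotient-realizable in $G$. Moreover, the existence of an ordering of the multiset with product $1$ is not sufficient; that is, there exist a finite nonabelian group $G$ and a multiset $A$ of cardinality $|G|$ with elements in $G$ such that the elements of $A$ can be ordered so that their product is $1$ in $G$, but $A$ is not quotient-realizable in $G$.
   Context: All multisets are counted with multiplicity; groups are written multiplicatively. Quotient-realizable: a multiset $A$ of cardinality $|G|$ with elements in a finite group $G$ is quotient-realizable in $G$ if there exist bijections $b,c:\{1,\ldots,|G|\}\to G$ such that $A=\{b(i)c(i)^{-1}:1\le i\le |G|\}$ as multisets. Abelianization condition: let $\pi:G\to G_{\mathrm{ab}}=G/[G,G]$ be the canonical projection. A multiset $A$ in $G$ satisfies the abelianization condition if $\prod_{a\in A}\pi(a)=1$ in $G_{\mathrm{ab}}$, the product being taken with multiplicity (independent of order since $G_{\mathrm{ab}}$ is abelian). *)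

theory Defs
  imports "HOL-Algebra.Algebra" "HOL-Library.Multiset"
begin

definition quotient_realizable :: "('a, 'b) monoid_scheme \<Rightarrow> 'a multiset \<Rightarrow> bool" where
  "quotient_realizable G A \<longleftrightarrow>
     (\<exists>b c. bij_betw b {1..order G} (carrier G) \<and> bij_betw c {1..order G} (carrier G) \<and>
        A = image_mset (\<lambda>i. b i \<otimes>\<^bsub>G\<^esub> inv\<^bsub>G\<^esub> (c i)) (mset_set {1..order G}))"

definition abelianization :: "('a, 'b) monoid_scheme \<Rightarrow> 'a set monoid" where
  "abelianization G = G Mod derived G (carrier G)"

definition abelianization_proj :: "('a, 'b) monoid_scheme \<Rightarrow> 'a \<Rightarrow> 'a set" where
  "abelianization_proj G a = derived G (carrier G) #>\<^bsub>G\<^esub> a"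

text \<open>The library's \<^const>\<open>finprod\<close> ranges over a set, so multiplicities appear as exponents.\<close>

definition abelianization_condition :: "('a, 'b) monoid_scheme \<Rightarrow> 'a multiset \<Rightarrow> bool" where
  "abelianization_condition G A \<longleftrightarrow>
     (\<Otimes>\<^bsub>abelianization G\<^esub> a \<in> set_mset A.
        abelianization_proj G a [^]\<^bsub>abelianization G\<^esub> count A a) = \<one>\<^bsub>abelianization G\<^esub>"

definition has_ordering_with_product_one :: "('a, 'b) monoid_scheme \<Rightarrow> 'a multiset \<Rightarrow> bool" where
  "has_ordering_with_product_one G A \<longleftrightarrow>
     (\<exists>xs. mset xs = A \<and> foldr (\<otimes>\<^bsub>G\<^esub>) xs \<one>\<^bsub>G\<^esub> = \<one>\<^bsub>G\<^esub>)"

end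

theory Submission
  imports Defs
begin

text \<open>
  If \<open>A\<close> consists of copies of \<open>s\<close> and two copies of \<open>t \<noteq> s\<close> and is the multiset of quotients
  \<open>b i * inv (c i)\<close>, then the bijections \<open>b\<close> and \<open>s * c\<close> differ at exactly two points, whose values
  they exchange; this forces \<open>(inv s * t)\<^sup>2 = 1\<close>. In the symmetric group of degree three, the
  multiset with four copies of a transposition \<open>s\<close> and two copies of a transposition \<open>t \<noteq> s\<close> has
  product \<open>1\<close>, yet \<open>inv s * t\<close> has order three.
\<close>

lemma (in group) quotient_realizable_two_exceptions:
  assumes "s \<in> carrier G" "t \<in> carrier G" "s \<noteq> t"
    and "quotient_realizable G (replicate_mset m s + replicate_mset 2 t)"
  shows "(inv s \<otimes> t) \<otimes> (inv s \<otimes> t) = \<one>"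
proof -
  let ?I = "{1..order G}"
  obtain b c where b: "bij_betw b ?I (carrier G)" and c: "bij_betw c ?I (carrier G)"
    and A: "replicate_mset m s + replicate_mset 2 t
      = image_mset (\<lambda>i. b i \<otimes> inv (c i)) (mset_set ?I)"
    using assms(4) unfolding quotient_realizable_def by blast
  define T where "T = {i \<in> ?I. b i \<otimes> inv (c i) = t}"
  have bG: "b i \<in> carrier G" and cG: "c i \<in> carrier G" if "i \<in> ?I" for i
    using b c that by (auto simp: bij_betw_def)
  have "card T = count (image_mset (\<lambda>i. b i \<otimes> inv (c i)) (mset_set ?I)) t"
    by (simp add: T_def count_image_mset vimage_def Int_def conj_commute)
  also have "\<dots> = 2"
    unfolding A [symmetric] using \<open>s \<noteq> t\<close> by simp
  finally obtain p q where T: "T = {p, q}" and "p \<noteq> q"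
    by (meson card_2_iff)
  have bT: "b i = t \<otimes> c i" if "i \<in> T" for i
    using that bG cG assms(2) by (auto simp: T_def m_assoc)
  have b_other: "b i = s \<otimes> c i" if "i \<in> ?I - T" for i
  proof -
    have "b i \<otimes> inv (c i) \<in># replicate_mset m s + replicate_mset 2 t"
      unfolding A using that by auto
    then have "b i \<otimes> inv (c i) = s"
      using that by (auto simp: T_def split: if_splits)
    then show ?thesis
      using that bG[of i] cG[of i] by (auto simp: m_assoc)
  qed
  \<comment> \<open>As \<open>s * c\<close> is onto, \<open>b p = s * c j\<close> for some
    \<open>j\<close>. If \<open>j\<close> were outside \<open>T\<close>, injectivity of
    \<open>b\<close> would give \<open>j = p\<close>, which lies in \<open>T\<close>; and
    \<open>j = p\<close> would give \<open>s = t\<close>. So \<open>j = q\<close>. Both orders of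
    the pair are used below.\<close>
  have swap: "s \<otimes> c q = t \<otimes> c p" if "T = {p, q}" for p q
  proof -
    have "p \<in> ?I" "q \<in> ?I" "p \<in> T"
      using that by (auto simp: T_def)
    then have "inv s \<otimes> b p \<in> c ` ?I"
      using c bG assms(1) by (auto simp: bij_betw_def)
    then obtain j where j: "j \<in> ?I" "c j = inv s \<otimes> b p"
      by auto
    then have bp: "b p = s \<otimes> c j"
      using bG[OF \<open>p \<in> ?I\<close>] assms(1) by (simp flip: m_assoc)
    have "j \<in> T"
    proof (rule ccontr)
      assume "j \<notin> T"
      then have "b j = b p"
        using bp b_other j by simp
      then have "j = p"
        using b j(1) \<open>p \<in> ?I\<close> by (auto simp: bij_betw_def dest: inj_onD)
      then show False
        using \<open>p \<in> T\<close> \<open>j \<notin> T\<close> by simp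
    qed
    moreover have "j \<noteq> p"
      using bp bT[OF \<open>p \<in> T\<close>] \<open>s \<noteq> t\<close> assms(1,2) cG[OF \<open>p \<in> ?I\<close>] by auto
    ultimately show ?thesis
      using bp bT[OF \<open>p \<in> T\<close>] that by auto
  qed
  have pq: "c p \<in> carrier G" "c q \<in> carrier G"
    using T cG by (auto simp: T_def)
  \<comment> \<open>Left multiplication by \<open>inv s * t\<close> exchanges \<open>c p\<close> and
    \<open>c q\<close>, so its square fixes \<open>c p\<close>.\<close>
  have "c q = (inv s \<otimes> t) \<otimes> c p" "c p = (inv s \<otimes> t) \<otimes> c q"
    using swap[of p q] swap[of q p] T pq assms(1,2)
    by (auto simp: insert_commute m_assoc inv_solve_left)
  then have "(inv s \<otimes> t) \<otimes> (inv s \<otimes> t) \<otimes> c p = c p"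
    using pq assms(1,2) by (simp add: m_assoc)
  then show ?thesis
    using pq assms(1,2) by (metis inv_closed m_closed r_cancel_one)
qed

text \<open>Each factor of the product is the image of \<open>a [^] count A a\<close> under the
  projection, hence trivial; this avoids computing the derived subgroup.\<close>

lemma (in group) abelianization_condition_if_pow_count:
  assumes "set_mset A \<subseteq> carrier G" and "\<And>a. a \<in># A \<Longrightarrow> a [^] count A a = \<one>"
  shows "abelianization_condition G A"
proof -
  let ?D = "derived G (carrier G)"
  have D: "?D \<lhd> G"
    by (rule derived_self_is_normal)
  interpret Q: comm_group "abelianization G"
    unfolding abelianization_def by (rule derived_quot_is_comm_group)
  have hom: "abelianization_proj G \<in> hom G (abelianization G)"
    using normal.r_coset_hom_Mod[OF D]
    by (simp add: abelianization_proj_def [abs_def] abelianization_def)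
  interpret h: group_hom G "abelianization G" "abelianization_proj G"
    by unfold_locales (rule hom)
  have "abelianization_proj G a [^]\<^bsub>abelianization G\<^esub> count A a = \<one>\<^bsub>abelianization G\<^esub>"
    if "a \<in># A" for a
    using that assms h.hom_nat_pow[of a "count A a"] by auto
  then show ?thesis
    unfolding abelianization_condition_def by (rule Q.finprod_one_eqI)
qed

text \<open>
  By the Chinese remainder theorem the residues modulo \<open>6\<close> under \<open>x * y = x + (- 1) ^ x * y\<close>
  form the semidirect product of \<open>\<int>/3\<close> by \<open>\<int>/2\<close>, that is, the symmetric group of degree three.
  The odd residues are the transpositions. The factor \<open>5\<close> represents \<open>- 1\<close>.
\<close>

definition S3 :: "nat monoid" where
  "S3 = \<lparr>carrier = {..<6}, monoid.mult = (\<lambda>x y. (if even x then x + y else x + 5 * y) mod 6), one = 0\<rparr>"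

lemma S3_simps [simp]:
  "carrier S3 = {..<6}" "\<one>\<^bsub>S3\<^esub> = 0"
  "x \<otimes>\<^bsub>S3\<^esub> y = (if even x then x + y else x + 5 * y) mod 6"
  by (simp_all add: S3_def)

lemma group_S3: "group S3"
proof (rule groupI)
  fix x y z assume "x \<in> carrier S3" "y \<in> carrier S3" "z \<in> carrier S3"
  then have "x \<in> {0,1,2,3,4,5}" "y \<in> {0,1,2,3,4,5}" "z \<in> {0,1,2,3,4,5}" by auto
  then show "x \<otimes>\<^bsub>S3\<^esub> y \<otimes>\<^bsub>S3\<^esub> z = x \<otimes>\<^bsub>S3\<^esub> (y \<otimes>\<^bsub>S3\<^esub> z)"
    by (elim insertE emptyE) simp_all
next
  fix x assume "x \<in> carrier S3"
  then have "x \<in> {0,1,2,3,4,5}" by auto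
  \<comment> \<open>Even residues are the rotations, inverted by negation; odd ones are
    involutions.\<close>
  then have "(if even x then (6 - x) mod 6 else x) \<in> carrier S3"
    "(if even x then (6 - x) mod 6 else x) \<otimes>\<^bsub>S3\<^esub> x = \<one>\<^bsub>S3\<^esub>"
    by (elim insertE emptyE; simp)+
  then show "\<exists>y\<in>carrier S3. y \<otimes>\<^bsub>S3\<^esub> x = \<one>\<^bsub>S3\<^esub>"
    by blast
qed auto

theorem corollary5p5:
  shows "(\<exists>(G :: nat monoid) A. group G \<and> finite (carrier G) \<and> \<not> comm_group G \<and>
            set_mset A \<subseteq> carrier G \<and> size A = order G \<and>
            abelianization_condition G A \<and> \<not> quotient_realizable G A) \<and>
         (\<exists>(G :: nat monoid) A. group G \<and> finite (carrier G) \<and> \<not> comm_group G \<and>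
            set_mset A \<subseteq> carrier G \<and> size A = order G \<and>
            has_ordering_with_product_one G A \<and> \<not> quotient_realizable G A)"
proof -
  interpret S3: group S3
    by (rule group_S3)
  \<comment> \<open>The odd residues 1 and 3 are the transpositions \<open>s\<close> and
    \<open>t\<close>; both multiplicities are even.\<close>
  define A :: "nat multiset" where "A = replicate_mset 4 1 + replicate_mset 2 3"
  have "\<not> comm_group S3"
  proof
    assume "comm_group S3"
    then interpret C: comm_group S3 .
    show False
      using C.m_comm[of 1 2] by simp
  qed
  moreover have "set_mset A \<subseteq> carrier S3" "size A = order S3"
    by (auto simp: A_def order_def)
  moreover have "abelianization_condition S3 A"
  proof (rule S3.abelianization_condition_if_pow_count)
    have "(1::nat) [^]\<^bsub>S3\<^esub> (4::nat) = 0" "(3::nat) [^]\<^bsub>S3\<^esub> (2::nat) = 0"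
      using S3.nat_pow_Suc[of _ "Suc 0", folded numeral_2_eq_2] S3.nat_pow_Suc[of _ 2]
        S3.nat_pow_Suc[of _ 3] by simp_all
    then show "a [^]\<^bsub>S3\<^esub> count A a = \<one>\<^bsub>S3\<^esub>" if "a \<in># A" for a
      using that by (auto simp: A_def)
  qed fact
  moreover have "has_ordering_with_product_one S3 A"
    unfolding has_ordering_with_product_one_def
    by (rule exI[of _ "[1, 1, 1, 1, 3, 3]"]) (auto simp: A_def intro: multiset_eqI)
  moreover have "\<not> quotient_realizable S3 A"
  proof
    assume "quotient_realizable S3 A"
    then have "(inv\<^bsub>S3\<^esub> 1 \<otimes>\<^bsub>S3\<^esub> 3) \<otimes>\<^bsub>S3\<^esub> (inv\<^bsub>S3\<^esub> 1 \<otimes>\<^bsub>S3\<^esub> 3) = \<one>\<^bsub>S3\<^esub>"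
      unfolding A_def by (intro S3.quotient_realizable_two_exceptions) auto
    moreover have "inv\<^bsub>S3\<^esub> 1 = 1"
      by (rule S3.inv_equality) auto
    \<comment> \<open>In \<open>S3\<close>, \<open>1 * 3 = 4\<close> and \<open>4 * 4 = 2\<close>,
      which is not the identity 0.\<close>
    ultimately show False
      by simp
  qed
  ultimately show ?thesis
    using group_S3 by (metis S3_simps(1) finite_lessThan)
qed

end
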